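(* Let $\mathbb F=\mathbb R$ or $\mathbb F=\mathbb C$ and let $1\le m<n$ be integers. If $\Phi\in\Omega_{n,m}(\mathbb F)$ is a $1$-Grassmannian frame (so that it has coherence $\mu(\Phi)=\mu_{n,m}(\mathbb F)$), then there exists a $1$-Grassmannian frame $\Phi'\in\Omega_{n,n-m}(\mathbb F)$, and its coherence is $\frac{m}{n-m}\,\mu_{n,m}(\mathbb F)$. More succinctly, $$\mu_{n,n-m}(\mathbb F)=\frac{m}{n-m}\,\mu_{n,m}(\mathbb F).$$
   Context: Let $\mathbb F=\mathbb R$ or $\mathbb C$, and let $m$ and $n$ be positive integers. A (finite) frame for $\mathbb F^m$ consisting of $n$ vectors is a family $\Phi=\{\phi_j\}_{j=1}^n\subset\mathbb F^m$ (indexed, repetitions allowed) with $\operatorname{span}\{\phi_j\}_{j=1}^n=\mathbb F^m$; it is identified with the $m\times n$ matrix whose columns are $\phi_1,\dots,\phi_n$. It is unit-norm if $\|\phi_j\|=1$ for all $j$, and tight if $\Phi\Phi^*=\sum_{j=1}^n\phi_j\phi_j^*=aI_m$ for some $a>0$. $\Omega_{n,m}(\mathbb F)$ denotes the space of unit-norm, tight frames for $\mathbb F^m$ consisting of $n$ vectors. The coherence of a family of unit vectors $\Phi=\{\phi_j\}_{j=1}^n$ is $\mu(\Phi)=\max_{j\ne l}|\langle\phi_j,\phi_l\rangle|$. The $1$-Grassmannian constant is $\mu_{n,m}(\mathbb F)=\min_{\Phi\in\Omega_{n,m}(\mathbb F)}\mu(\Phi)$ (the minimum exists, by compactness of $\Omega_{n,m}(\mathbb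 F)$). A frame $\Phi\in\Omega_{n,m}(\mathbb F)$ is called a $1$-Grassmannian frame if $\mu(\Phi)=\mu_{n,m}(\mathbb F)$. *)

theory Defs
  imports
    "Jordan_Normal_Form.VS_Connect"
    "Jordan_Normal_Form.Schur_Decomposition"
    "HOL-Analysis.L2_Norm"
begin

text \<open>
  The dimensions \<open>m\<close> and \<open>n - m\<close> occur in the same statement, so vectors and matrices are those
  of \<open>Jordan_Normal_Form\<close>, with their dimensions given by carriers. The scalar type is constrained
  to the classes that provide both the conjugation and the absolute value; it is only ever
  instantiated to \<open>real\<close> (where \<open>conjugate\<close> is the identity) and \<open>complex\<close> (where it is \<open>cnj\<close>).
  A family of \<open>n\<close> vectors is the matrix having them as columns, numbered from \<open>0\<close>.
\<close>

definition is_frame :: "nat \<Rightarrow> nat \<Rightarrow> 'a :: field mat \<Rightarrow> bool" where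
  "is_frame n m \<Phi> \<longleftrightarrow> \<Phi> \<in> carrier_mat m n \<and> vec_space.col_space m \<Phi> = carrier_vec m"

definition l2_norm_vec :: "'a :: real_normed_field vec \<Rightarrow> real" where
  "l2_norm_vec v = L2_set (\<lambda>i. norm (v $ i)) {..<dim_vec v}"

definition unit_norm :: "'a :: real_normed_field mat \<Rightarrow> bool" where
  "unit_norm \<Phi> \<longleftrightarrow> (\<forall>j < dim_col \<Phi>. l2_norm_vec (col \<Phi> j) = 1)"

definition tight :: "'a :: {conjugatable_field, real_normed_field} mat \<Rightarrow> bool" where
  "tight \<Phi> \<longleftrightarrow> (\<exists>a :: real. a > 0 \<and> \<Phi> * mat_adjoint \<Phi> = of_real a \<cdot>\<^sub>m 1\<^sub>m (dim_row \<Phi>))"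

definition unit_tight_frames ::
    "nat \<Rightarrow> nat \<Rightarrow> 'a :: {conjugatable_field, real_normed_field} mat set" where
  "unit_tight_frames n m = {\<Phi>. is_frame n m \<Phi> \<and> unit_norm \<Phi> \<and> tight \<Phi>}"

text \<open>
  The maximum is over an empty set, hence unspecified, when there are fewer than two columns.
\<close>

definition coherence :: "'a :: {conjugatable_field, real_normed_field} mat \<Rightarrow> real" where
  "coherence \<Phi> = Max {norm (col \<Phi> j \<bullet>c col \<Phi> l) | j l. j < dim_col \<Phi> \<and> l < dim_col \<Phi> \<and> j \<noteq> l}"

text \<open>
  \<open>LEAST\<close> denotes the minimum of the set of coherences; it is meaningful because that minimum is
  attained (the set of unit-norm tight frames is compact, and nonempty for \<open>n \<ge> m \<ge> 1\<close>).
\<close>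

definition grassmannian_constant ::
    "'a :: {conjugatable_field, real_normed_field} itself \<Rightarrow> nat \<Rightarrow> nat \<Rightarrow> real" where
  "grassmannian_constant _ n m =
    (LEAST x. x \<in> coherence ` (unit_tight_frames n m :: 'a mat set))"

definition grassmannian_frame ::
    "nat \<Rightarrow> nat \<Rightarrow> 'a :: {conjugatable_field, real_normed_field} mat \<Rightarrow> bool" where
  "grassmannian_frame n m \<Phi> \<longleftrightarrow>
    \<Phi> \<in> unit_tight_frames n m \<and> coherence \<Phi> = grassmannian_constant TYPE('a) n m"

end

(* Defs is imported last so that mat and row denote the constants of Jordan_Normal_Form,
   not those of Finite_Cartesian_Product. *)
theory Submission
  imports "HOL-Analysis.Function_Topology" "HOL-Analysis.Topology_Euclidean_Space" Defs
begin

text \<open>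
  The rows of \<open>sqrt (m/n) \<Phi>\<close> are orthonormal; extend them to an orthonormal basis of the space of
  row vectors of length \<open>n\<close>. The new rows, scaled by \<open>sqrt (n/(n - m))\<close>, form the Naimark
  complement of \<open>\<Phi>\<close>: since the resulting square matrix is unitary, its columns are orthonormal as
  well, so the off-diagonal Gram entries of the complement are those of \<open>\<Phi>\<close> times \<open>- m/(n - m)\<close>.
  Taking complements is thus a correspondence between both spaces of frames which multiplies the
  coherence by \<open>m/(n - m)\<close>, and its inverse direction is the same construction. The identity between
  the constants moreover requires that the minima exist. This follows from compactness, together with
  nonemptiness, which is itself obtained from complements.
\<close>

section \<open>Conjugation and norm\<close>

text \<open>Covers \<open>real\<close> and \<open>complex\<close> at once, so that each argument is
  given a single time. The axiom ties conjugation to the absolute value; \<open>heine_borel\<close>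
  makes closed balls compact, on which the existence of the minimum rests.\<close>

class normed_conjugatable_field = conjugatable_field + real_normed_field + heine_borel +
  assumes mult_conjugate_scaleR: "x * conjugate x = (norm x)\<^sup>2 *\<^sub>R 1"

instance real :: normed_conjugatable_field
  by standard (simp add: power2_eq_square)

instance complex :: normed_conjugatable_field
  by standard
    (simp only: scaleR_conv_of_real complex_norm_square conjugate_complex_def mult_1_right)

lemma mult_conjugate:
  "x * conjugate x = of_real ((norm (x :: 'a :: normed_conjugatable_field))\<^sup>2)"
  by (simp only: mult_conjugate_scaleR of_real_def)

lemma norm_conjugate: "norm (conjugate x) = norm (x :: 'a :: normed_conjugatable_field)"
proof (cases "x = 0")
  case False
  have "norm x * norm (conjugate x) = norm x * norm x"
    using arg_cong[OF mult_conjugate[of x], of norm]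
    by (simp add: norm_mult power2_eq_square)
  with False show ?thesis by simp
qed simp

lemma conjugate_diff:
  "conjugate (x - y) = conjugate x - conjugate (y :: 'a :: normed_conjugatable_field)"
  by (metis conjugate_dist_add conjugate_neg diff_conv_add_uminus)

text \<open>A nonnegative real is \<open>sqrt b\<close> times its own conjugate, a product whose
  factors conjugation merely swaps; negative reals follow by a change of sign.\<close>

lemma conjugate_of_real:
  "conjugate (of_real a) = (of_real a :: 'a :: normed_conjugatable_field)"
proof -
  have nonneg: "conjugate (of_real b) = (of_real b :: 'a)" if "b \<ge> 0" for b
  proof -
    have b: "(of_real b :: 'a) = of_real (sqrt b) * conjugate (of_real (sqrt b))"
      using that by (simp add: mult_conjugate)
    show ?thesis
      unfolding b by (simp add: conjugate_dist_mul mult.commute)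
  qed
  show ?thesis
  proof (cases "a \<ge> 0")
    case False
    then have "- conjugate (of_real a) = - (of_real a :: 'a)"
      using nonneg[of "- a"] by (simp only: of_real_minus conjugate_neg)
    then show ?thesis by (simp only: neg_equal_iff_equal)
  qed (rule nonneg)
qed

lemma continuous_on_conjugate [continuous_intros]:
  fixes f :: "'b :: topological_space \<Rightarrow> 'a :: normed_conjugatable_field"
  assumes "continuous_on S f"
  shows "continuous_on S (\<lambda>x. conjugate (f x))"
proof -
  \<comment> \<open>Conjugation is an isometry, hence continuous.\<close>
  have dist_conj: "dist (conjugate x) (conjugate y) = dist x y" for x y :: 'a
    by (metis dist_norm norm_conjugate conjugate_diff)
  have "continuous_on UNIV (conjugate :: 'a \<Rightarrow> 'a)"
    unfolding continuous_on_iff dist_conj by blast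
  from continuous_on_compose2[OF this assms subset_UNIV] show ?thesis .
qed

lemma sum_lessThan_add:
  fixes f :: "nat \<Rightarrow> 'a :: comm_monoid_add"
  shows "(\<Sum>i<a + b. f i) = (\<Sum>i<a. f i) + (\<Sum>i<b. f (a + i))"
  by (induction b) (simp_all add: add.assoc)

lemma continuous_on_Max:
  fixes f :: "'i \<Rightarrow> 'b :: topological_space \<Rightarrow> real"
  assumes "finite I" and "I \<noteq> {}" and "\<And>i. i \<in> I \<Longrightarrow> continuous_on S (f i)"
  shows "continuous_on S (\<lambda>x. Max ((\<lambda>i. f i x) ` I))"
  using assms
proof (induction I rule: finite_ne_induct)
  case (insert i I)
  then have "continuous_on S (\<lambda>x. max (f i x) (Max ((\<lambda>i. f i x) ` I)))"
    by (intro continuous_on_max) auto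
  with insert.hyps show ?case by simp
qed simp

section \<open>Orthonormal families\<close>

text \<open>Rows are functions on all naturals, so a row can be appended by function update and the
  number of rows can vary.\<close>

definition orthonormal_family ::
    "nat \<Rightarrow> nat \<Rightarrow> (nat \<Rightarrow> nat \<Rightarrow> 'a :: normed_conjugatable_field) \<Rightarrow> bool" where
  "orthonormal_family n k r \<longleftrightarrow>
    (\<forall>i<k. \<forall>j<k. (\<Sum>l<n. r i l * conjugate (r j l)) = (if i = j then 1 else 0))"

text \<open>Zero rows complete the \<open>k\<close> orthogonality conditions to a singular square system.\<close>

lemma ex_unit_orthogonal:
  fixes r :: "nat \<Rightarrow> nat \<Rightarrow> 'a :: normed_conjugatable_field"
  assumes "k < n"
  shows "\<exists>v. (\<Sum>l<n. v l * conjugate (v l)) = 1 \<and>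
             (\<forall>i<k. (\<Sum>l<n. v l * conjugate (r i l)) = 0)"
proof -
  define A where "A = mat n n (\<lambda>(i, l). if i < k then conjugate (r i l) else 0)"
  have A: "A \<in> carrier_mat n n" by (simp add: A_def)
  have "A = mat\<^sub>r n n (\<lambda>i. if i = k then 0\<^sub>v n else row A i)"
    using assms by (intro eq_matI) (auto simp: A_def)
  then have "det A = 0"
    using det_row_0[OF assms, of "row A"] A by simp
  then obtain v where v: "v \<in> carrier_vec n" "v \<noteq> 0\<^sub>v n" "A *\<^sub>v v = 0\<^sub>v n"
    using det_0_iff_vec_prod_zero_field[OF A] by blast
  have orth: "(\<Sum>l<n. v $ l * conjugate (r i l)) = 0" if "i < k" for i
  proof -
    have "(A *\<^sub>v v) $ i = 0" using v(3) that assms by simp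
    then show ?thesis
      using that assms v(1)
      by (simp add: A_def scalar_prod_def lessThan_atLeast0 mult.commute)
  qed
  define N where "N = sqrt (\<Sum>l<n. (norm (v $ l))\<^sup>2)"
  obtain l where l: "l < n" "v $ l \<noteq> 0"
    using v(1,2) by (metis carrier_vecD eq_vecI index_zero_vec)
  have "0 < (norm (v $ l))\<^sup>2" using l by simp
  also have "\<dots> \<le> (\<Sum>l<n. (norm (v $ l))\<^sup>2)"
    using l by (intro member_le_sum) auto
  finally have N: "N > 0" "N\<^sup>2 = (\<Sum>l<n. (norm (v $ l))\<^sup>2)"
    by (auto simp: N_def)
  define w where "w l = of_real (1 / N) * v $ l" for l
  have "(\<Sum>l<n. w l * conjugate (w l)) = of_real (\<Sum>l<n. (norm (v $ l))\<^sup>2 / N\<^sup>2)"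
    using N(1) by (simp add: mult_conjugate w_def norm_mult power_divide norm_divide)
  also have "\<dots> = 1"
    using N(1) by (simp flip: sum_divide_distrib N(2))
  finally have "(\<Sum>l<n. w l * conjugate (w l)) = 1" .
  moreover have "(\<Sum>l<n. w l * conjugate (r i l)) = 0" if "i < k" for i
    using orth[OF that] unfolding w_def mult.assoc sum_distrib_left[symmetric] by simp
  ultimately show ?thesis by blast
qed

text \<open>One row at a time: as long as fewer than \<open>n\<close> rows are present, some unit
  vector is orthogonal to all of them.\<close>

lemma orthonormal_family_extend:
  assumes "orthonormal_family n k r" and "k + d \<le> n"
  shows "\<exists>s. orthonormal_family n (k + d) s \<and> (\<forall>i<k. s i = r i)"
  using assms(2)
proof (induction d)
  case 0
  then show ?case using assms(1) by auto
next
  case (Suc d)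
  then obtain s where s: "orthonormal_family n (k + d) s" "\<forall>i<k. s i = r i" by auto
  obtain v where v: "(\<Sum>l<n. v l * conjugate (v l)) = 1"
      "\<And>i. i < k + d \<Longrightarrow> (\<Sum>l<n. v l * conjugate (s i l)) = 0"
    using ex_unit_orthogonal[of "k + d" n s] Suc.prems by auto
  \<comment> \<open>The products in the reverse order vanish as conjugates of those just
    obtained.\<close>
  have v': "(\<Sum>l<n. s i l * conjugate (v l)) = 0" if "i < k + d" for i
  proof -
    have "(\<Sum>l<n. s i l * conjugate (v l)) = conjugate (\<Sum>l<n. v l * conjugate (s i l))"
      by (simp add: sum_conjugate conjugate_dist_mul mult.commute)
    then show ?thesis by (simp add: v(2)[OF that])
  qed
  have "orthonormal_family n (k + Suc d) (s(k + d := v))"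
    using s(1) v v' by (auto simp: orthonormal_family_def less_Suc_eq)
  moreover have "\<forall>i<k. (s(k + d := v)) i = r i" using s(2) by simp
  ultimately show ?case by blast
qed

text \<open>For square matrices a right inverse is also a left inverse, so orthonormal rows force
  orthonormal columns.\<close>

lemma orthonormal_family_columns:
  assumes "orthonormal_family n n r" and "j < n" and "l < n"
  shows "(\<Sum>i<n. r i j * conjugate (r i l)) = (if j = l then 1 else 0)"
proof -
  define U where "U = mat n n (\<lambda>(i, l). r i l)"
  define V where "V = mat n n (\<lambda>(l, i). conjugate (r i l))"
  have U: "U \<in> carrier_mat n n" and V: "V \<in> carrier_mat n n" by (simp_all add: U_def V_def)
  have "U * V = 1\<^sub>m n"
    using assms(1) unfolding orthonormal_family_def U_def V_def
    by (intro eq_matI) (auto simp: scalar_prod_def lessThan_atLeast0)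
  then have "V * U = 1\<^sub>m n" by (rule mat_mult_left_right_inverse[OF U V])
  \<comment> \<open>The indices are swapped because \<open>V\<close>, the conjugated factor, stands
    first.\<close>
  then have "(V * U) $$ (l, j) = (if j = l then 1 else 0)"
    using assms(2,3) by simp
  moreover have "(V * U) $$ (l, j) = (\<Sum>i<n. conjugate (r i l) * r i j)"
    using assms(2,3) by (simp add: U_def V_def scalar_prod_def lessThan_atLeast0)
  ultimately show ?thesis by (simp only: mult.commute)
qed

section \<open>Unit-norm tight frames and their complements\<close>

lemma mat_adjoint_carrier:
  "\<Phi> \<in> carrier_mat m n \<Longrightarrow> mat_adjoint \<Phi> \<in> carrier_mat n m"
  by (auto simp: mat_adjoint_def)

lemma index_mult_mat_adjoint:
  assumes "\<Phi> \<in> carrier_mat m n" and "i < m" and "k < m"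
  shows "(\<Phi> * mat_adjoint \<Phi>) $$ (i, k) = (\<Sum>j<n. \<Phi> $$ (i, j) * conjugate (\<Phi> $$ (k, j)))"
  using assms by (auto simp: mat_adjoint_def scalar_prod_def lessThan_atLeast0 mat_of_rows_def)

lemma tight_iff:
  fixes \<Phi> :: "'a :: normed_conjugatable_field mat"
  assumes "\<Phi> \<in> carrier_mat m n"
  shows "tight \<Phi> \<longleftrightarrow> (\<exists>a>0. \<forall>i<m. \<forall>k<m.
    (\<Sum>j<n. \<Phi> $$ (i, j) * conjugate (\<Phi> $$ (k, j))) = (if i = k then of_real a else 0))"
proof -
  have "\<Phi> * mat_adjoint \<Phi> = of_real a \<cdot>\<^sub>m 1\<^sub>m (dim_row \<Phi>) \<longleftrightarrow> (\<forall>i<m. \<forall>k<m.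
    (\<Sum>j<n. \<Phi> $$ (i, j) * conjugate (\<Phi> $$ (k, j))) = (if i = k then of_real a else 0))" for a
    using assms mat_adjoint_carrier[OF assms]
    by (auto simp: mat_eq_iff index_mult_mat_adjoint[OF assms] simp del: index_mult_mat(1))
  then show ?thesis by (simp add: tight_def)
qed

lemma unit_norm_iff:
  assumes "\<Phi> \<in> carrier_mat m n"
  shows "unit_norm \<Phi> \<longleftrightarrow> (\<forall>j<n. (\<Sum>i<m. (norm (\<Phi> $$ (i, j)))\<^sup>2) = 1)"
  using assms by (auto simp: unit_norm_def l2_norm_vec_def L2_set_def)

text \<open>Every \<open>v\<close> is the image under \<Phi> of
  \<open>mat_adjoint \<Phi> *\<^sub>v v\<close> divided by \<open>a\<close>, so the columns
  span.\<close>

lemma is_frame_if_tight: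
  fixes \<Phi> :: "'a :: normed_conjugatable_field mat"
  assumes \<Phi>: "\<Phi> \<in> carrier_mat m n" and "tight \<Phi>"
  shows "is_frame n m \<Phi>"
proof -
  obtain a where a: "a > 0" "\<Phi> * mat_adjoint \<Phi> = of_real a \<cdot>\<^sub>m 1\<^sub>m m"
    using assms by (auto simp: tight_def)
  have "\<exists>x\<in>carrier_vec n. \<Phi> *\<^sub>v x = v" if v: "v \<in> carrier_vec m" for v
  proof
    let ?x = "of_real (1 / a) \<cdot>\<^sub>v (mat_adjoint \<Phi> *\<^sub>v v)"
    have adj: "mat_adjoint \<Phi> *\<^sub>v v \<in> carrier_vec n"
      using mat_adjoint_carrier[OF \<Phi>] v by auto
    then show "?x \<in> carrier_vec n" by simp
    have "\<Phi> *\<^sub>v ?x = of_real (1 / a) \<cdot>\<^sub>v ((\<Phi> * mat_adjoint \<Phi>) *\<^sub>v v)"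
      using \<Phi> adj v mat_adjoint_carrier[OF \<Phi>]
      by (simp add: mult_mat_vec[OF \<Phi> adj] assoc_mult_mat_vec[OF \<Phi>])
    also have "\<dots> = of_real (1 / a) \<cdot>\<^sub>v (of_real a \<cdot>\<^sub>v v)"
      using v by (auto simp: a(2) intro!: eq_vecI)
    also have "\<dots> = v" using a(1) by (auto intro!: eq_vecI)
    finally show "\<Phi> *\<^sub>v ?x = v" .
  qed
  then show ?thesis
    using \<Phi> vec_space.col_space_eq[OF \<Phi>] by (auto simp: is_frame_def)
qed

text \<open>Reduces membership to finitely many equations in the entries, with the frame bound
  pinned to \<open>n / m\<close>. This form serves both the constructions of frames and the
  compactness argument.\<close>

lemma unit_tight_frames_iff:
  fixes \<Phi> :: "'a :: normed_conjugatable_field mat"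
  assumes "1 \<le> m" and "1 \<le> n"
  shows "\<Phi> \<in> unit_tight_frames n m \<longleftrightarrow> \<Phi> \<in> carrier_mat m n \<and>
    (\<forall>j<n. (\<Sum>i<m. (norm (\<Phi> $$ (i, j)))\<^sup>2) = 1) \<and>
    (\<forall>i<m. \<forall>k<m. (\<Sum>j<n. \<Phi> $$ (i, j) * conjugate (\<Phi> $$ (k, j))) =
      (if i = k then of_real (real n / real m) else 0))"
    (is "_ \<longleftrightarrow> ?C \<and> ?U \<and> ?T (real n / real m)")
proof
  assume "\<Phi> \<in> unit_tight_frames n m"
  then have C: ?C and U: ?U and "tight \<Phi>"
    by (auto simp: unit_tight_frames_def is_frame_def unit_norm_iff)
  then obtain a where T: "?T a" by (auto simp: tight_iff)
  \<comment> \<open>The trace of the frame operator, computed by rows and by columns, determines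
    \<open>a\<close>.\<close>
  have "(of_real (m * a) :: 'a) = (\<Sum>i<m. \<Sum>j<n. \<Phi> $$ (i, j) * conjugate (\<Phi> $$ (i, j)))"
    using T by simp
  also have "\<dots> = of_real (\<Sum>j<n. \<Sum>i<m. (norm (\<Phi> $$ (i, j)))\<^sup>2)"
    by (subst sum.swap) (simp add: mult_conjugate)
  also have "\<dots> = of_real n" using U by simp
  finally have "m * a = n" by (simp only: of_real_eq_iff)
  then have "a = real n / real m" using assms(1) by (simp add: field_simps)
  with C U T show "?C \<and> ?U \<and> ?T (real n / real m)" by blast
next
  assume *: "?C \<and> ?U \<and> ?T (real n / real m)"
  then have "tight \<Phi>"
    using assms by (subst tight_iff[of _ m n]) (auto intro!: exI[of _ "real n / real m"])
  with * show "\<Phi> \<in> unit_tight_frames n m"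
    by (auto simp: unit_tight_frames_def is_frame_if_tight unit_norm_iff)
qed

lemma coherence_eq:
  fixes \<Phi> :: "'a :: normed_conjugatable_field mat"
  assumes "\<Phi> \<in> carrier_mat m n"
  shows "coherence \<Phi> =
    Max ((\<lambda>(j, l). norm (\<Sum>i<m. \<Phi> $$ (i, j) * conjugate (\<Phi> $$ (i, l))))
      ` {(j, l). j < n \<and> l < n \<and> j \<noteq> l})"
proof -
  have "norm (col \<Phi> j \<bullet>c col \<Phi> l) = norm (\<Sum>i<m. \<Phi> $$ (i, j) * conjugate (\<Phi> $$ (i, l)))"
    if "j < n" "l < n" for j l
    using assms that by (simp add: scalar_prod_def lessThan_atLeast0)
  then have "(\<lambda>(j, l). norm (col \<Phi> j \<bullet>c col \<Phi> l)) ` {(j, l). j < n \<and> l < n \<and> j \<noteq> l} =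
    (\<lambda>(j, l). norm (\<Sum>i<m. \<Phi> $$ (i, j) * conjugate (\<Phi> $$ (i, l))))
      ` {(j, l). j < n \<and> l < n \<and> j \<noteq> l}"
    by (intro image_cong) auto
  moreover have "{f j l | j l. P j l} = (\<lambda>(j, l). f j l) ` {(j, l). P j l}"
    for f :: "nat \<Rightarrow> nat \<Rightarrow> real" and P by auto
  ultimately show ?thesis using assms by (simp only: coherence_def carrier_matD)
qed

text \<open>With at least two columns, the maximum in the coherence is over a nonempty finite
  set.\<close>

lemma column_pairs_nonempty_finite:
  assumes "2 \<le> (n :: nat)"
  shows "{(j, l). j < n \<and> l < n \<and> j \<noteq> l} \<noteq> {}"
    and "finite {(j, l). j < n \<and> l < n \<and> j \<noteq> l}"
proof -
  have "(0, 1) \<in> {(j, l). j < n \<and> l < n \<and> j \<noteq> l}" using assms by auto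
  then show "{(j, l). j < n \<and> l < n \<and> j \<noteq> l} \<noteq> {}" by blast
  show "finite {(j, l). j < n \<and> l < n \<and> j \<noteq> l}"
    by (rule finite_subset[of _ "{..<n} \<times> {..<n}"]) auto
qed

section \<open>Naimark complements\<close>

lemma naimark_complement:
  fixes \<Phi> :: "'a :: normed_conjugatable_field mat"
  assumes mn: "1 \<le> m" "m < n" and \<Phi>: "\<Phi> \<in> unit_tight_frames n m"
  shows "\<exists>\<Psi> \<in> unit_tight_frames n (n - m) :: 'a mat set.
    coherence \<Psi> = real m / real (n - m) * coherence \<Phi>"
proof -
  from \<Phi> have C: "\<Phi> \<in> carrier_mat m n"
    and U: "\<And>j. j < n \<Longrightarrow> (\<Sum>i<m. (norm (\<Phi> $$ (i, j)))\<^sup>2) = 1"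
    and T: "\<And>i k. i < m \<Longrightarrow> k < m \<Longrightarrow> (\<Sum>j<n. \<Phi> $$ (i, j) * conjugate (\<Phi> $$ (k, j))) =
      (if i = k then of_real (real n / real m) else 0)"
    using mn by (auto simp: unit_tight_frames_iff)
  \<comment> \<open>The rows of \<Phi> have squared norm \<open>n / m\<close>, so \<open>c\<close>
    normalizes them. The new rows form columns of squared norm \<open>(n - m) / n\<close>, which
    \<open>d\<close> scales to unit vectors.\<close>
  define c where "c = sqrt (real m / real n)"
  define d where "d = sqrt (real n / real (n - m))"
  have c2: "c * c = real m / real n" and d2: "d * d = real n / real (n - m)"
    by (simp_all add: c_def d_def)
  have scale: "(of_real e * x) * conjugate (of_real e * y) = of_real (e * e) * (x * conjugate y)"
    for e and x y :: 'a
    by (simp add: conjugate_dist_mul conjugate_of_real ac_simps)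
  define r where "r i j = of_real c * \<Phi> $$ (i, j)" for i j
  have "orthonormal_family n m r"
    unfolding orthonormal_family_def r_def scale sum_distrib_left[symmetric] c2
    using mn by (auto simp: T simp flip: of_real_mult)
  from orthonormal_family_extend[OF this, of "n - m"] mn
  obtain s where s: "orthonormal_family n n s" "\<And>i. i < m \<Longrightarrow> s i = r i" by auto
  define \<Psi> where "\<Psi> = mat (n - m) n (\<lambda>(i, j). of_real d * s (m + i) j)"
  have \<Psi>C: "\<Psi> \<in> carrier_mat (n - m) n" by (simp add: \<Psi>_def)
  \<comment> \<open>The columns of the full unitary matrix are orthonormal, and its first
    \<open>m\<close> rows account for \<open>c * c\<close> times the Gram matrix of \<Phi>; the
    remaining rows account for the difference.\<close>
  have gram: "(\<Sum>i<n - m. \<Psi> $$ (i, j) * conjugate (\<Psi> $$ (i, l))) = of_real (d * d) *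
      ((if j = l then 1 else 0) -
        of_real (c * c) * (\<Sum>i<m. \<Phi> $$ (i, j) * conjugate (\<Phi> $$ (i, l))))"
    if jl: "j < n" "l < n" for j l
  proof -
    have "(\<Sum>i<n - m. s (m + i) j * conjugate (s (m + i) l)) =
        (\<Sum>i<n. s i j * conjugate (s i l)) - (\<Sum>i<m. s i j * conjugate (s i l))"
      using sum_lessThan_add[of "\<lambda>i. s i j * conjugate (s i l)" m "n - m"] mn by simp
    also have "\<dots> = (if j = l then 1 else 0) -
        of_real (c * c) * (\<Sum>i<m. \<Phi> $$ (i, j) * conjugate (\<Phi> $$ (i, l)))"
      using orthonormal_family_columns[OF s(1) jl]
      by (simp add: s(2) r_def scale sum_distrib_left del: of_real_mult)
    finally show ?thesis
      using jl by (simp add: \<Psi>_def scale flip: sum_distrib_left del: of_real_mult)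
  qed
  have "(\<Sum>i<n - m. (norm (\<Psi> $$ (i, j)))\<^sup>2) = 1" if j: "j < n" for j
  proof -
    have "(of_real (\<Sum>i<n - m. (norm (\<Psi> $$ (i, j)))\<^sup>2) :: 'a) =
        of_real (d * d * (1 - c * c * (\<Sum>i<m. (norm (\<Phi> $$ (i, j)))\<^sup>2)))"
      using gram[OF j j] by (simp add: mult_conjugate)
    also have "d * d * (1 - c * c * (\<Sum>i<m. (norm (\<Phi> $$ (i, j)))\<^sup>2)) = 1"
      unfolding c2 d2 U[OF j] using mn by (simp add: of_nat_diff field_simps)
    finally show ?thesis by (simp only: of_real_eq_iff)
  qed
  moreover have "(\<Sum>j<n. \<Psi> $$ (i, j) * conjugate (\<Psi> $$ (k, j))) =
      (if i = k then of_real (real n / real (n - m)) else 0)" if "i < n - m" "k < n - m" for i k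
  proof -
    have "(\<Sum>j<n. \<Psi> $$ (i, j) * conjugate (\<Psi> $$ (k, j))) =
        of_real (d * d) * (\<Sum>j<n. s (m + i) j * conjugate (s (m + k) j))"
      using that by (simp add: \<Psi>_def scale sum_distrib_left del: of_real_mult)
    also have "(\<Sum>j<n. s (m + i) j * conjugate (s (m + k) j)) = (if i = k then 1 else 0)"
      using s(1) that by (simp add: orthonormal_family_def)
    finally show ?thesis by (simp add: d2 del: of_real_mult)
  qed
  ultimately have "\<Psi> \<in> unit_tight_frames n (n - m)"
    using mn \<Psi>C by (simp add: unit_tight_frames_iff)
  moreover have "coherence \<Psi> = real m / real (n - m) * coherence \<Phi>"
  proof -
    let ?P = "{(j, l). j < n \<and> l < n \<and> j \<noteq> l}"
    have dc: "d * d * (c * c) = real m / real (n - m)"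
      unfolding c2 d2 using mn by simp
    \<comment> \<open>Off the diagonal the identity drops out and only a multiple of the Gram entry
      of \<Phi> is left.\<close>
    have off: "norm (\<Sum>i<n - m. \<Psi> $$ (i, j) * conjugate (\<Psi> $$ (i, l))) =
        real m / real (n - m) * norm (\<Sum>i<m. \<Phi> $$ (i, j) * conjugate (\<Phi> $$ (i, l)))"
      if "j < n" "l < n" "j \<noteq> l" for j l
    proof -
      have "(\<Sum>i<n - m. \<Psi> $$ (i, j) * conjugate (\<Psi> $$ (i, l))) =
          - (of_real (d * d * (c * c)) * (\<Sum>i<m. \<Phi> $$ (i, j) * conjugate (\<Phi> $$ (i, l))))"
        using gram[OF that(1,2)] that(3) by simp
      then show ?thesis by (simp only: dc norm_minus_cancel norm_mult norm_of_real) simp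
    qed
    have "coherence \<Psi> = Max ((*) (real m / real (n - m)) `
        (\<lambda>(j, l). norm (\<Sum>i<m. \<Phi> $$ (i, j) * conjugate (\<Phi> $$ (i, l)))) ` ?P)"
      unfolding coherence_eq[OF \<Psi>C] image_image
      by (intro arg_cong[of _ _ Max] image_cong) (auto simp: off)
    \<comment> \<open>Multiplication by a nonnegative constant is monotone, hence commutes with the
      maximum.\<close>
    also have "\<dots> = real m / real (n - m) * coherence \<Phi>"
      unfolding coherence_eq[OF C] using column_pairs_nonempty_finite[of n] mn
      by (subst mono_Max_commute) (auto intro!: monoI mult_left_mono divide_right_mono)
    finally show ?thesis .
  qed
  ultimately show ?thesis by (rule bexI[rotated])
qed

text \<open>The same construction, started in dimension \<open>n - m\<close>, leads back to
  dimension \<open>m\<close>.\<close>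

lemma naimark_complement_converse:
  fixes \<Psi> :: "'a :: normed_conjugatable_field mat"
  assumes "1 \<le> m" "m < n" and "\<Psi> \<in> unit_tight_frames n (n - m)"
  shows "\<exists>\<Phi> \<in> unit_tight_frames n m :: 'a mat set.
    coherence \<Phi> = real (n - m) / real m * coherence \<Psi>"
proof -
  have "1 \<le> n - m" "n - m < n" "n - (n - m) = m" using assms by auto
  with naimark_complement[of "n - m" n \<Psi>] assms(3) show ?thesis by metis
qed

section \<open>Existence of unit-norm tight frames\<close>

text \<open>Appending an orthonormal basis adds the identity to the frame operator, which stays
  scalar: \<open>n / m\<close> becomes \<open>(n + m) / m\<close>.\<close>

lemma unit_tight_frames_append_basis:
  fixes \<Phi> :: "'a :: normed_conjugatable_field mat"
  assumes mn: "1 \<le> m" "1 \<le> n" and \<Phi>: "\<Phi> \<in> unit_tight_frames n m"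
  shows "mat m (n + m) (\<lambda>(i, j). if j < n then \<Phi> $$ (i, j) else if j = n + i then 1 else 0)
    \<in> unit_tight_frames (n + m) m" (is "?\<Psi> \<in> _")
proof -
  from \<Phi> have C: "\<Phi> \<in> carrier_mat m n"
    and U: "\<And>j. j < n \<Longrightarrow> (\<Sum>i<m. (norm (\<Phi> $$ (i, j)))\<^sup>2) = 1"
    and T: "\<And>i k. i < m \<Longrightarrow> k < m \<Longrightarrow> (\<Sum>j<n. \<Phi> $$ (i, j) * conjugate (\<Phi> $$ (k, j))) =
      (if i = k then of_real (real n / real m) else 0)"
    using mn by (auto simp: unit_tight_frames_iff)
  have one: "conjugate 1 = (1 :: 'a)" using conjugate_of_real[of 1, where ?'a = 'a] by simp
  have "(\<Sum>i<m. (norm (?\<Psi> $$ (i, j)))\<^sup>2) = 1" if j: "j < n + m" for j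
  proof (cases "j < n")
    case True
    then show ?thesis using U j by simp
  next
    case False
    then have "(\<Sum>i<m. (norm (?\<Psi> $$ (i, j)))\<^sup>2) = (\<Sum>i<m. if i = j - n then 1 else 0)"
      using j by (intro sum.cong) auto
    then show ?thesis using False j by simp
  qed
  moreover have "(\<Sum>j<n + m. ?\<Psi> $$ (i, j) * conjugate (?\<Psi> $$ (k, j))) =
      (if i = k then of_real (real (n + m) / real m) else 0)" if ik: "i < m" "k < m" for i k
  proof -
    let ?g = "\<lambda>j. ?\<Psi> $$ (i, j) * conjugate (?\<Psi> $$ (k, j))"
    have "(\<Sum>j<n + m. ?g j) = (\<Sum>j<n. ?g j) + (\<Sum>j<m. ?g (n + j))"
      by (rule sum_lessThan_add)
    also have "(\<Sum>j<n. ?g j) = (if i = k then of_real (real n / real m) else 0)"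
      using T ik by simp
    also have "(\<Sum>j<m. ?g (n + j)) = (\<Sum>j<m. if j = i then (if i = k then 1 else 0) else 0)"
      using ik by (intro sum.cong) (auto simp: one)
    also have "\<dots> = (if i = k then 1 else 0)" using ik by simp
    finally show ?thesis using mn by (simp add: add_divide_distrib)
  qed
  ultimately show ?thesis using mn by (simp add: unit_tight_frames_iff)
qed

text \<open>
  A Euclidean descent on \<open>(n, m)\<close>: for \<open>2 m \<le> n\<close> append an orthonormal basis to a frame of \<open>n - m\<close>
  vectors, for \<open>m < n < 2 m\<close> pass to the complement.
\<close>

lemma unit_tight_frames_nonempty:
  assumes "1 \<le> m" and "m \<le> n"
  shows "(unit_tight_frames n m :: 'a :: normed_conjugatable_field mat set) \<noteq> {}"
  using assms
proof (induction n arbitrary: m rule: less_induct)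
  case (less n)
  \<comment> \<open>Stated for arbitrary \<open>k\<close>, since the last case below needs it for
    \<open>n - m\<close>. The induction hypothesis applies at \<open>n - k\<close>, as
    \<open>2 * k \<le> n\<close> gives \<open>k \<le> n - k\<close>.\<close>
  have double: "(unit_tight_frames n k :: 'a mat set) \<noteq> {}" if k: "1 \<le> k" "2 * k \<le> n" for k
  proof -
    obtain \<Phi> :: "'a mat" where "\<Phi> \<in> unit_tight_frames (n - k) k"
      using less.IH[of "n - k" k] k by fastforce
    from unit_tight_frames_append_basis[OF _ _ this] k show ?thesis by force
  qed
  consider "m = n" | "2 * m \<le> n" | "m < n" "n < 2 * m" using less.prems by linarith
  then show ?case
  proof cases
    case 1
    have one: "conjugate 1 = (1 :: 'a)" using conjugate_of_real[of 1, where ?'a = 'a] by simp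
    have "(1\<^sub>m n :: 'a mat) \<in> unit_tight_frames n n"
      using 1 less.prems
      by (auto simp: unit_tight_frames_iff if_distrib[of norm] if_distrib[of conjugate] one
          if_distrib[of "\<lambda>x. x\<^sup>2"] if_distrib[of "\<lambda>x. _ * x"] cong: if_cong)
    then show ?thesis using 1 by blast
  next
    case 2
    then show ?thesis using double less.prems by blast
  next
    case 3
    \<comment> \<open>Complementation keeps \<open>n\<close>, so the descent takes place inside
      \<open>double\<close>; it applies because \<open>n < 2 * m\<close> gives
      \<open>2 * (n - m) \<le> n\<close>.\<close>
    then obtain \<Phi> :: "'a mat" where "\<Phi> \<in> unit_tight_frames n (n - m)"
      using double[of "n - m"] by fastforce
    with naimark_complement_converse[OF less.prems(1) 3(1)] show ?thesis by blast
  qed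
qed

section \<open>Existence of the minimum\<close>

lemma coherence_attains_min:
  assumes "1 \<le> m" and "m < n"
  shows "\<exists>\<Phi> \<in> unit_tight_frames n m :: 'a :: normed_conjugatable_field mat set.
    \<forall>\<Psi> \<in> unit_tight_frames n m :: 'a mat set. coherence \<Phi> \<le> coherence \<Psi>"
proof -
  \<comment> \<open>Matrices are parametrized by functions on all index pairs. \<open>K\<close> is a
    product of closed unit balls, compact by Tychonoff's theorem; \<open>S\<close> is cut out by the
    frame equations, which are closed conditions.\<close>
  define K where "K = (UNIV :: (nat \<times> nat) set) \<rightarrow>\<^sub>E cball (0 :: 'a) 1"
  define S where "S = {f :: nat \<times> nat \<Rightarrow> 'a.
    (\<forall>j<n. (\<Sum>i<m. (norm (f (i, j)))\<^sup>2) = 1) \<and>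
    (\<forall>i<m. \<forall>k<m. (\<Sum>j<n. f (i, j) * conjugate (f (k, j))) =
      (if i = k then of_real (real n / real m) else 0))}"
  have coord: "continuous_on A (\<lambda>f. f p)" for A and p :: "nat \<times> nat"
    by (rule continuous_on_subset[OF continuous_on_product_coordinates subset_UNIV])
  have "compactin (product_topology (\<lambda>_. euclidean) UNIV) K"
    unfolding K_def compactin_PiE by simp
  then have "compact K" by (simp add: euclidean_product_topology)
  moreover have "closed S"
    unfolding S_def
    by (intro closed_Collect_conj closed_Collect_all closed_Collect_imp closed_Collect_eq
        continuous_intros coord) auto
  ultimately have "compact (K \<inter> S)" by (rule compact_Int_closed)
  have mat_iff: "mat m n f \<in> unit_tight_frames n m \<longleftrightarrow> f \<in> S" for f
    using assms by (simp add: unit_tight_frames_iff S_def)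
  have surj: "\<exists>f \<in> K \<inter> S. mat m n f = \<Phi>" if \<Phi>: "\<Phi> \<in> unit_tight_frames n m" for \<Phi>
  proof
    \<comment> \<open>Extension by zero keeps the coordinates outside the matrix in the unit ball;
      inside, entries of unit columns have norm at most 1. Hence restricting to \<open>K\<close>
      loses no frame.\<close>
    let ?f = "\<lambda>(i, j). if i < m \<and> j < n then \<Phi> $$ (i, j) else 0"
    have C: "\<Phi> \<in> carrier_mat m n"
      and U: "\<And>j. j < n \<Longrightarrow> (\<Sum>i<m. (norm (\<Phi> $$ (i, j)))\<^sup>2) = 1"
      using assms \<Phi> by (auto simp: unit_tight_frames_iff)
    show eq: "mat m n ?f = \<Phi>" using C by (intro eq_matI) auto
    have "norm (\<Phi> $$ (i, j)) \<le> 1" if ij: "i < m" "j < n" for i j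
    proof -
      have "(norm (\<Phi> $$ (i, j)))\<^sup>2 \<le> (\<Sum>i<m. (norm (\<Phi> $$ (i, j)))\<^sup>2)"
        using ij by (intro member_le_sum) auto
      then show ?thesis using U[OF ij(2)] by (simp add: power_le_one_iff abs_square_le_1)
    qed
    then have "?f \<in> K" by (auto simp: K_def)
    then show "?f \<in> K \<inter> S" using \<Phi> eq mat_iff[of ?f] by simp
  qed
  \<comment> \<open>The coherence is a maximum of finitely many continuous functions of the
    entries.\<close>
  have "continuous_on (K \<inter> S) (\<lambda>f. Max ((\<lambda>p. norm (\<Sum>i<m. f (i, fst p) *
      conjugate (f (i, snd p)))) ` {(j, l). j < n \<and> l < n \<and> j \<noteq> l}))"
    using column_pairs_nonempty_finite[of n] assms
    by (intro continuous_on_Max continuous_intros coord) auto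
  moreover have "Max ((\<lambda>p. norm (\<Sum>i<m. f (i, fst p) *
      conjugate (f (i, snd p)))) ` {(j, l). j < n \<and> l < n \<and> j \<noteq> l}) = coherence (mat m n f)"
    for f :: "nat \<times> nat \<Rightarrow> 'a"
    unfolding coherence_eq[OF mat_carrier]
    by (intro arg_cong[of _ _ Max] image_cong) auto
  ultimately have "continuous_on (K \<inter> S) (\<lambda>f. coherence (mat m n f))" by simp
  moreover have "K \<inter> S \<noteq> {}"
    using surj unit_tight_frames_nonempty[of m n, where ?'a = 'a] assms by fastforce
  ultimately obtain f where f: "f \<in> K \<inter> S"
      "\<forall>g \<in> K \<inter> S. coherence (mat m n f) \<le> coherence (mat m n g)"
    using continuous_attains_inf[OF \<open>compact (K \<inter> S)\<close>] by blast
  show ?thesis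
  proof (intro bexI ballI)
    show "mat m n f \<in> unit_tight_frames n m" using f(1) mat_iff by blast
    show "coherence (mat m n f) \<le> coherence \<Psi>" if "\<Psi> \<in> unit_tight_frames n m"
      for \<Psi> :: "'a mat"
      using surj[OF that] f(2) by blast
  qed
qed

section \<open>Transfer of the minimum to the complement\<close>

lemma grassmannian_constant_eqI:
  fixes \<Phi> :: "'a :: normed_conjugatable_field mat"
  assumes "\<Phi> \<in> unit_tight_frames n m"
    and "\<And>\<Psi> :: 'a mat. \<Psi> \<in> unit_tight_frames n m \<Longrightarrow> coherence \<Phi> \<le> coherence \<Psi>"
  shows "grassmannian_constant TYPE('a) n m = coherence \<Phi>"
  unfolding grassmannian_constant_def using assms by (intro Least_equality) auto

text \<open>Attainment of the minimum makes the \<open>LEAST\<close> in the definition a genuine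
  lower bound.\<close>

lemma grassmannian_constant_le:
  fixes \<Phi> :: "'a :: normed_conjugatable_field mat"
  assumes "1 \<le> m" and "m < n" and "\<Phi> \<in> unit_tight_frames n m"
  shows "grassmannian_constant TYPE('a) n m \<le> coherence \<Phi>"
  using coherence_attains_min[OF assms(1,2), where ?'a = 'a] assms(3) grassmannian_constant_eqI
  by metis

text \<open>A frame in dimension \<open>n - m\<close> with smaller coherence than the complement of
  \<Phi> would have a complement that beats \<Phi>.\<close>

lemma naimark_complement_minimal:
  fixes \<Phi> :: "'a :: normed_conjugatable_field mat"
  assumes mn: "1 \<le> m" "m < n" and \<Phi>: "grassmannian_frame n m \<Phi>"
  shows "\<exists>\<Psi> :: 'a mat. grassmannian_frame n (n - m) \<Psi> \<and>
    coherence \<Psi> = real m / real (n - m) * grassmannian_constant TYPE('a) n m"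
proof -
  obtain \<Psi> :: "'a mat" where \<Psi>: "\<Psi> \<in> unit_tight_frames n (n - m)"
      "coherence \<Psi> = real m / real (n - m) * coherence \<Phi>"
    using naimark_complement[OF mn] \<Phi> unfolding grassmannian_frame_def by blast
  have "coherence \<Psi> \<le> coherence \<Psi>'" if \<Psi>': "\<Psi>' \<in> unit_tight_frames n (n - m)" for \<Psi>' :: "'a mat"
  proof -
    obtain \<Phi>' :: "'a mat" where \<Phi>': "\<Phi>' \<in> unit_tight_frames n m"
        "coherence \<Phi>' = real (n - m) / real m * coherence \<Psi>'"
      using naimark_complement_converse[OF mn] \<Psi>' by blast
    have "coherence \<Phi> \<le> coherence \<Phi>'"
      using grassmannian_constant_le[OF mn \<Phi>'(1)] \<Phi> by (simp add: grassmannian_frame_def)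
    then have "real m / real (n - m) * coherence \<Phi> \<le> real m / real (n - m) * coherence \<Phi>'"
      by (rule mult_left_mono) simp
    \<comment> \<open>The factors \<open>m / (n - m)\<close> and \<open>(n - m) / m\<close>
      cancel.\<close>
    then show ?thesis using \<Psi>(2) \<Phi>'(2) mn by simp
  qed
  with \<Psi>(1) have "grassmannian_constant TYPE('a) n (n - m) = coherence \<Psi>"
    by (rule grassmannian_constant_eqI)
  with \<Psi> \<Phi> show ?thesis by (auto simp: grassmannian_frame_def)
qed

text \<open>A minimizer is a Grassmannian frame, and the coherence of its Grassmannian complement is
  the constant for \<open>n - m\<close>.\<close>

lemma grassmannian_constant_complement:
  assumes mn: "1 \<le> m" "m < n"
  shows "grassmannian_constant TYPE('a :: normed_conjugatable_field) n (n - m) =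
    real m / real (n - m) * grassmannian_constant TYPE('a) n m"
proof -
  obtain \<Phi> :: "'a mat" where "\<Phi> \<in> unit_tight_frames n m"
      "\<forall>\<Psi> \<in> unit_tight_frames n m :: 'a mat set. coherence \<Phi> \<le> coherence \<Psi>"
    using coherence_attains_min[OF mn] by blast
  then have "grassmannian_frame n m \<Phi>"
    by (simp add: grassmannian_frame_def grassmannian_constant_eqI[of \<Phi> n m])
  from naimark_complement_minimal[OF mn this] show ?thesis
    by (auto simp: grassmannian_frame_def)
qed

theorem theorem4:
  fixes m n :: nat
  assumes "1 \<le> m" and "m < n"
  shows
    "((\<forall>\<Phi> :: real mat. grassmannian_frame n m \<Phi> \<longrightarrow>
        (\<exists>\<Phi>' :: real mat. grassmannian_frame n (n - m) \<Phi>' \<and>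
          coherence \<Phi>' = real m / real (n - m) * grassmannian_constant TYPE(real) n m)) \<and>
      grassmannian_constant TYPE(real) n (n - m) =
        real m / real (n - m) * grassmannian_constant TYPE(real) n m) \<and>
     ((\<forall>\<Phi> :: complex mat. grassmannian_frame n m \<Phi> \<longrightarrow>
        (\<exists>\<Phi>' :: complex mat. grassmannian_frame n (n - m) \<Phi>' \<and>
          coherence \<Phi>' = real m / real (n - m) * grassmannian_constant TYPE(complex) n m)) \<and>
      grassmannian_constant TYPE(complex) n (n - m) =
        real m / real (n - m) * grassmannian_constant TYPE(complex) n m)"
  by (intro conjI allI impI naimark_complement_minimal[OF assms]
      grassmannian_constant_complement[OF assms])

end
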